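(* Let $X$ be a compact Hausdorff space, let $\mu$ be a finite topological measure on $X$ and let $(\mu_\alpha)$ be a net of finite topological measures on $X$. The following are equivalent: (1) $\int_X f\, d\mu_\alpha \to \int_X f\, d\mu$ for every $f \in C(X)$. (2) $\liminf \mu_\alpha(U) \ge \mu(U)$ for any open $U\subseteq X$, and $\lim \mu_\alpha(X)=\mu(X)$. (3) $\limsup \mu_\alpha(D)\le\mu(D)$ for any closed $D\subseteq X$, and $\lim\mu_\alpha(X)=\mu(X)$. (4) $\mu_\alpha(A)\to\mu(A)$ for any $\mu$-continuity set $A$ (where $A$ is open or closed). (5) If $f\in C_0^+(X)$ then $R_{2,\mu_\alpha,f}(t)\to R_{2,\mu,f}(t)$ and $R_{1,\mu_\alpha,f}(t)\to R_{1,\mu,f}(t)$ for each point $t$ at which $R_{2,\mu,f}$ is continuous.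
   Context: $\mathcal{O}(X)$, $\mathcal{C}(X)$, $\mathcal{K}(X)$ are the collections of open, closed, compact subsets of $X$. A topological measure on a locally compact Hausdorff space $X$ is a set function $\mu:\mathcal{C}(X)\cup\mathcal{O}(X)\to[0,\infty]$, not identically $\infty$, such that: (TM1) if $A,B,A\sqcup B\in\mathcal{K}(X)\cup\mathcal{O}(X)$ (disjoint union) then $\mu(A\sqcup B)=\mu(A)+\mu(B)$; (TM2) $\mu(U)=\sup\{\mu(K):K\in\mathcal{K}(X),\ K\subseteq U\}$ for $U\in\mathcal{O}(X)$; (TM3) $\mu(F)=\inf\{\mu(U):U\in\mathcal{O}(X),\ F\subseteq U\}$ for $F\in\mathcal{C}(X)$. It is finite if $\mu(X)<\infty$. $C(X)$ is the set of real-valued continuous functions on $X$; $C_0^+(X)$ is the set of nonnegative continuous functions vanishing at infinity (for compact $X$: all nonnegative continuous functions). For a finite topological measure $\mu$, a bounded continuous $f:X\to\mathbb{R}$ and $t\in\mathbb{R}$ put $R_{1,\mu,f}(t)=\mu(f^{-1}((t,\infty)))$, $R_{2,\mu,f}(t)=\mu(f^{-1}([t,\infty)))$. The (generally non-linear) quasi-integral is $\int_X f\,d\mu=\mathcal{R}_\mu(f)=\int_a^b R_{1,\mu,f}(t)\,dt+a\mu(X)=\int_a^b R_{2,\mu,f}(t)\,dt+a\mu(X)$, where $[a,b]$ is any interval containing $f(X)$. A set $A$ is a $\mu$-continuity set if $\mu(\overline{A})=\mu(A^o)$, where $A^o$ is the interior of $A$. *)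

theory Defs
  imports "HOL-Analysis.Analysis"
begin

(* A set function on the open and closed subsets of X is modelled by a total function on sets;
   its values on other sets are unconstrained. *)
definition topological_measure :: "'a topology \<Rightarrow> ('a set \<Rightarrow> ennreal) \<Rightarrow> bool" where
  "topological_measure X \<mu> \<longleftrightarrow>
     (\<exists>A. (closedin X A \<or> openin X A) \<and> \<mu> A \<noteq> \<infinity>) \<and>
     (\<forall>A B. (compactin X A \<or> openin X A) \<and> (compactin X B \<or> openin X B) \<and>
            (compactin X (A \<union> B) \<or> openin X (A \<union> B)) \<and> A \<inter> B = {} \<longrightarrow>
            \<mu> (A \<union> B) = \<mu> A + \<mu> B) \<and>
     (\<forall>U. openin X U \<longrightarrow> \<mu> U = (SUP K\<in>{K. compactin X K \<and> K \<subseteq> U}. \<mu> K)) \<and>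
     (\<forall>F. closedin X F \<longrightarrow> \<mu> F = (INF U\<in>{U. openin X U \<and> F \<subseteq> U}. \<mu> U))"

definition finite_topological_measure :: "'a topology \<Rightarrow> ('a set \<Rightarrow> ennreal) \<Rightarrow> bool" where
  "finite_topological_measure X \<mu> \<longleftrightarrow> topological_measure X \<mu> \<and> \<mu> (topspace X) < \<infinity>"

definition C0_plus :: "'a topology \<Rightarrow> ('a \<Rightarrow> real) set" where
  "C0_plus X = {f. continuous_map X euclideanreal f \<and> (\<forall>x\<in>topspace X. 0 \<le> f x) \<and>
                   (\<forall>e>0. compactin X {x \<in> topspace X. e \<le> \<bar>f x\<bar>})}"

(* The conversion to real loses nothing in R1 and R2, which are used for finite measures only. *)
definition R1 :: "'a topology \<Rightarrow> ('a set \<Rightarrow> ennreal) \<Rightarrow> ('a \<Rightarrow> real) \<Rightarrow> real \<Rightarrow> real" where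
  "R1 X \<mu> f t = enn2real (\<mu> {x \<in> topspace X. f x \<in> {t<..}})"

definition R2 :: "'a topology \<Rightarrow> ('a set \<Rightarrow> ennreal) \<Rightarrow> ('a \<Rightarrow> real) \<Rightarrow> real \<Rightarrow> real" where
  "R2 X \<mu> f t = enn2real (\<mu> {x \<in> topspace X. f x \<in> {t..}})"

(* The common value over all intervals containing the range of f; existence and uniqueness
   are established in quasi_integral_eq below. *)
definition quasi_integral :: "'a topology \<Rightarrow> ('a set \<Rightarrow> ennreal) \<Rightarrow> ('a \<Rightarrow> real) \<Rightarrow> real" where
  "quasi_integral X \<mu> f =
     (THE r. \<forall>a b. a \<le> b \<and> f ` topspace X \<subseteq> {a..b} \<longrightarrow>
        r = integral {a..b} (R1 X \<mu> f) + a * enn2real (\<mu> (topspace X)))"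

definition continuity_set :: "'a topology \<Rightarrow> ('a set \<Rightarrow> ennreal) \<Rightarrow> 'a set \<Rightarrow> bool" where
  "continuity_set X \<mu> A \<longleftrightarrow>
     A \<subseteq> topspace X \<and> \<mu> (X closure_of A) = \<mu> (X interior_of A)"

definition directed_set :: "'i set \<Rightarrow> ('i \<times> 'i) set \<Rightarrow> bool" where
  "directed_set I r \<longleftrightarrow>
     I \<noteq> {} \<and> preorder_on I r \<and> (\<forall>i\<in>I. \<forall>j\<in>I. \<exists>k\<in>I. (i, k) \<in> r \<and> (j, k) \<in> r)"

(* The filter generated by the tails of I; (i, j) \<in> r reads as i \<le> j. *)
definition net_filter :: "'i set \<Rightarrow> ('i \<times> 'i) set \<Rightarrow> 'i filter" where
  "net_filter I r = (INF i\<in>I. principal {j \<in> I. (i, j) \<in> r})"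

lemma eventually_net_filter:
  assumes "directed_set I r"
  shows "eventually P (net_filter I r) \<longleftrightarrow> (\<exists>i\<in>I. \<forall>j\<in>I. (i, j) \<in> r \<longrightarrow> P j)"
proof -
  have tr: "trans r" and ne: "I \<noteq> {}"
    and dir: "\<And>i j. i \<in> I \<Longrightarrow> j \<in> I \<Longrightarrow> \<exists>k\<in>I. (i, k) \<in> r \<and> (j, k) \<in> r"
    using assms by (auto simp: directed_set_def preorder_on_def)
  have "eventually P (net_filter I r) \<longleftrightarrow>
      (\<exists>i\<in>I. eventually P (principal {j \<in> I. (i, j) \<in> r}))"
    unfolding net_filter_def
  proof (rule eventually_INF_base[OF ne])
    fix i j assume "i \<in> I" "j \<in> I"
    then obtain k where "k \<in> I" "(i, k) \<in> r" "(j, k) \<in> r"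
      using dir by blast
    then show "\<exists>x\<in>I. principal {l \<in> I. (x, l) \<in> r}
        \<le> inf (principal {l \<in> I. (i, l) \<in> r}) (principal {l \<in> I. (j, l) \<in> r})"
      by (intro bexI[of _ k]) (auto intro: transD[OF tr])
  qed
  then show ?thesis
    by (auto simp: eventually_principal)
qed

lemma topological_measure_open_mono:
  assumes "topological_measure X \<mu>" "openin X U" "openin X V" "U \<subseteq> V"
  shows "\<mu> U \<le> \<mu> V"
proof -
  have "\<mu> U = (SUP K\<in>{K. compactin X K \<and> K \<subseteq> U}. \<mu> K)"
    and "\<mu> V = (SUP K\<in>{K. compactin X K \<and> K \<subseteq> V}. \<mu> K)"
    using assms by (auto simp: topological_measure_def)
  then show ?thesis
    using \<open>U \<subseteq> V\<close> by (auto intro!: SUP_subset_mono)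
qed

lemma finite_topological_measure_empty:
  assumes "finite_topological_measure X \<mu>"
  shows "\<mu> {} = 0"
proof -
  have tm: "topological_measure X \<mu>" and fin: "\<mu> (topspace X) < \<infinity>"
    using assms by (auto simp: finite_topological_measure_def)
  have "\<mu> ({} \<union> {}) = \<mu> {} + \<mu> {}"
    using tm unfolding topological_measure_def by (metis Int_empty_left Un_empty_left openin_empty)
  moreover have "\<mu> {} < \<infinity>"
    using topological_measure_open_mono[OF tm openin_empty openin_topspace] fin
    by (meson empty_subsetI order_le_less_trans)
  ultimately show ?thesis
    by (metis Un_empty_left add.right_neutral ennreal_add_left_cancel infinity_ennreal_def less_irrefl)
qed

lemma
  assumes \<mu>: "finite_topological_measure X \<mu>" and f: "continuous_map X euclideanreal f"
  shows R1_decreasing: "s \<le> t \<Longrightarrow> R1 X \<mu> f t \<le> R1 X \<mu> f s"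
    and R1_below: "f ` topspace X \<subseteq> {a..b} \<Longrightarrow> t < a \<Longrightarrow> R1 X \<mu> f t = enn2real (\<mu> (topspace X))"
    and R1_above: "f ` topspace X \<subseteq> {a..b} \<Longrightarrow> b \<le> t \<Longrightarrow> R1 X \<mu> f t = 0"
proof -
  have tm: "topological_measure X \<mu>" and fin: "\<mu> (topspace X) < \<infinity>"
    using \<mu> by (auto simp: finite_topological_measure_def)
  have op: "openin X {x \<in> topspace X. f x \<in> {t<..}}" for t
    using openin_continuous_map_preimage[OF f, of "{t<..}"] by simp
  have "\<mu> {x \<in> topspace X. f x \<in> {t<..}} < top" for t
    using topological_measure_open_mono[OF tm op openin_topspace, of t] fin
    by (metis (no_types, lifting) infinity_ennreal_def mem_Collect_eq order_le_less_trans subsetI)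
  moreover have "\<mu> {x \<in> topspace X. f x \<in> {t<..}} \<le> \<mu> {x \<in> topspace X. f x \<in> {s<..}}" if "s \<le> t" for s t
    by (rule topological_measure_open_mono[OF tm op op]) (use that in auto)
  ultimately show "s \<le> t \<Longrightarrow> R1 X \<mu> f t \<le> R1 X \<mu> f s"
    unfolding R1_def by (intro enn2real_mono) auto
  show "R1 X \<mu> f t = enn2real (\<mu> (topspace X))" if "f ` topspace X \<subseteq> {a..b}" "t < a"
  proof -
    have "{x \<in> topspace X. f x \<in> {t<..}} = topspace X"
      using that by fastforce
    then show ?thesis by (simp add: R1_def)
  qed
  show "R1 X \<mu> f t = 0" if "f ` topspace X \<subseteq> {a..b}" "b \<le> t"
  proof -
    have "{x \<in> topspace X. f x \<in> {t<..}} = {}"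
      using that by fastforce
    then show ?thesis
      unfolding R1_def by (simp add: finite_topological_measure_empty[OF \<mu>] del: Collect_empty_eq)
  qed
qed

lemma R1_integrable:
  assumes "finite_topological_measure X \<mu>" "continuous_map X euclideanreal f"
  shows "R1 X \<mu> f integrable_on {a..b}"
proof -
  have "mono_on {a..b} (\<lambda>t. - R1 X \<mu> f t)"
    by (intro mono_onI) (simp add: R1_decreasing[OF assms])
  then have "(\<lambda>t. - R1 X \<mu> f t) integrable_on {a..b}"
    by (rule integrable_on_mono_on)
  from integrable_neg[OF this] show ?thesis by simp
qed

lemma quasi_integral_eq:
  assumes \<mu>: "finite_topological_measure X \<mu>" and f: "continuous_map X euclideanreal f"
    and ab: "a \<le> b" "f ` topspace X \<subseteq> {a..b}"
  shows "quasi_integral X \<mu> f = integral {a..b} (R1 X \<mu> f) + a * enn2real (\<mu> (topspace X))"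
proof -
  let ?m = "enn2real (\<mu> (topspace X))"
  have ext: "integral {c..d} (R1 X \<mu> f) + c * ?m = integral {a..b} (R1 X \<mu> f) + a * ?m"
    if ab: "a \<le> b" "f ` topspace X \<subseteq> {a..b}" and cd: "c \<le> a" "b \<le> d" for a b c d
  proof -
    have "integral {c..a} (R1 X \<mu> f) = integral {c..a} (\<lambda>_. ?m)"
      by (rule integral_spike[of "{a}"]) (use R1_below[OF \<mu> f ab(2)] in auto)
    moreover have "integral {b..d} (R1 X \<mu> f) = integral {b..d} (\<lambda>_. 0)"
      by (rule integral_cong) (use R1_above[OF \<mu> f ab(2)] in auto)
    moreover have "integral {c..a} (R1 X \<mu> f) + integral {a..d} (R1 X \<mu> f) = integral {c..d} (R1 X \<mu> f)"
      by (rule Henstock_Kurzweil_Integration.integral_combine) (use ab cd R1_integrable[OF \<mu> f] in auto)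
    moreover have "integral {a..b} (R1 X \<mu> f) + integral {b..d} (R1 X \<mu> f) = integral {a..d} (R1 X \<mu> f)"
      by (rule Henstock_Kurzweil_Integration.integral_combine) (use ab cd R1_integrable[OF \<mu> f] in auto)
    ultimately show ?thesis
      using cd by (simp add: algebra_simps)
  qed
  have uniq: "integral {c..d} (R1 X \<mu> f) + c * ?m = integral {a..b} (R1 X \<mu> f) + a * ?m"
    if "c \<le> d" "f ` topspace X \<subseteq> {c..d}" for c d
    using ext[of c d "min a c" "max b d"] ext[of a b "min a c" "max b d"] that ab by simp
  show ?thesis
    unfolding quasi_integral_def
  proof (rule the_equality)
    show "\<forall>c d. c \<le> d \<and> f ` topspace X \<subseteq> {c..d} \<longrightarrow>
        integral {a..b} (R1 X \<mu> f) + a * ?m = integral {c..d} (R1 X \<mu> f) + c * ?m"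
      using uniq by metis
  qed (use ab in blast)
qed

end

theory Submission
  imports Defs
begin

text \<open>
  The argument rests on the interplay of open and closed sets. In a compact Hausdorff space
  complements turn lower bounds for the masses of open sets into upper bounds for the masses of
  closed sets as soon as the total masses converge, so \<open>c2\<close> and \<open>c3\<close> are two
  readings of one condition (lemma \<open>open_liminf_iff_closed_limsup\<close>). A set is squeezed
  between its interior and its closure, which yields \<open>c4\<close> from the two readings together;
  and at a continuity point of \<open>R2\<close> the sets \<open>{f > t}\<close> and \<open>{f \<ge> t}\<close> have
  the same mass and are therefore continuity sets, which yields \<open>c5\<close>.

  The way back to open sets goes through Urysohn functions (lemma \<open>Urysohn_layer\<close>): an open
  set \<open>U\<close> is exhausted from inside by compact sets \<open>K\<close>, and both the integral and the
  layers of a function squeezed between the indicators of \<open>K\<close> and \<open>U\<close> lie between the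
  masses of \<open>K\<close> and \<open>U\<close>. Thus \<open>c1\<close> and \<open>c5\<close> each imply
  \<open>c2\<close>, without any linearity of the integral; suitable constant functions give the total
  mass.

  It remains to derive \<open>c1\<close> from \<open>c2\<close> and \<open>c3\<close>. For a net, pointwise
  convergence of the layer functions does not pass to integrals by dominated convergence. Since
  they are decreasing, however, their integrals lie between lower and upper Riemann sums whose
  difference is at most the mesh times the total mass (lemma
  \<open>decreasing_Riemann_bounds\<close>). A Riemann sum involves only finitely many superlevel sets:
  the open ones bound lower sums from below through \<open>c2\<close>, the closed ones bound upper sums
  from above through \<open>c3\<close>.
\<close>

section \<open>Convergence expressed by one-sided bounds\<close>

lemma tendsto_real_iff_bounds:
  fixes f :: "'b \<Rightarrow> real"
  shows "(f \<longlongrightarrow> L) F \<longleftrightarrow>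
    (\<forall>e>0. \<forall>\<^sub>F x in F. L - e < f x) \<and> (\<forall>e>0. \<forall>\<^sub>F x in F. f x < L + e)"
proof -
  have "(\<forall>\<^sub>F x in F. dist (f x) L < e) \<longleftrightarrow>
      (\<forall>\<^sub>F x in F. L - e < f x) \<and> (\<forall>\<^sub>F x in F. f x < L + e)" for e
    unfolding eventually_conj_iff[symmetric]
    by (intro arg_cong[where f="\<lambda>P. eventually P F"] ext) (auto simp: dist_real_def)
  then show ?thesis
    unfolding tendsto_iff by blast
qed

text \<open>For finite masses, one-sided limits in \<open>[0, \<infinity>]\<close> are the same as
  \<open>\<epsilon>\<close>-bounds between reals. In the reals the mass of a complement is a difference,
  and linear arithmetic applies.\<close>

lemma le_Liminf_enn2real_iff:
  assumes c: "c < top" and g: "\<forall>\<^sub>F x in F. g x < (top::ennreal)"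
  shows "c \<le> Liminf F g \<longleftrightarrow> (\<forall>e>0. \<forall>\<^sub>F x in F. enn2real c - e < enn2real (g x))"
proof (intro iffI allI impI)
  fix e :: real assume L: "c \<le> Liminf F g" and e: "0 < e"
  show "\<forall>\<^sub>F x in F. enn2real c - e < enn2real (g x)"
  proof (cases "enn2real c < e")
    case True
    then have "enn2real c - e < enn2real (g x)" for x
      by (rule_tac less_le_trans[of _ 0]) auto
    then show ?thesis by simp
  next
    case False
    have "ennreal (enn2real c - e) < ennreal (enn2real c)"
      using False e by (intro ennreal_lessI) auto
    then have "ennreal (enn2real c - e) < c"
      using c by simp
    with L have "\<forall>\<^sub>F x in F. ennreal (enn2real c - e) < g x"
      by (simp add: le_Liminf_iff)
    then show ?thesis
      using g
    proof eventually_elim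
      case (elim x)
      then have "ennreal (enn2real c - e) < ennreal (enn2real (g x))"
        by simp
      then show ?case
        using False by (simp add: ennreal_less_iff)
    qed
  qed
next
  assume R: "\<forall>e>0. \<forall>\<^sub>F x in F. enn2real c - e < enn2real (g x)"
  show "c \<le> Liminf F g"
    unfolding le_Liminf_iff
  proof (intro allI impI)
    fix y assume y: "y < c"
    then have fin: "y < top"
      using c by (meson order_less_trans)
    have "enn2real y < enn2real c"
      using y c by (simp add: enn2real_less_iff fin)
    then have "\<forall>\<^sub>F x in F. enn2real c - (enn2real c - enn2real y) < enn2real (g x)"
      using R by (metis diff_gt_0_iff_gt)
    then show "\<forall>\<^sub>F x in F. y < g x"
      using g
    proof eventually_elim
      case (elim x)
      then have "ennreal (enn2real y) < ennreal (enn2real (g x))"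
        by (intro ennreal_lessI) (auto intro: le_less_trans[OF enn2real_nonneg])
      then show ?case
        using elim fin by simp
    qed
  qed
qed

lemma Limsup_le_enn2real_iff:
  assumes c: "c < top" and g: "\<forall>\<^sub>F x in F. g x < (top::ennreal)"
  shows "Limsup F g \<le> c \<longleftrightarrow> (\<forall>e>0. \<forall>\<^sub>F x in F. enn2real (g x) < enn2real c + e)"
proof (intro iffI allI impI)
  fix e :: real assume L: "Limsup F g \<le> c" and e: "0 < e"
  have "ennreal (enn2real c) < ennreal (enn2real c + e)"
    using e by (intro ennreal_lessI) (auto intro: add_nonneg_pos)
  then have "c < ennreal (enn2real c + e)"
    using c by simp
  with L have "\<forall>\<^sub>F x in F. g x < ennreal (enn2real c + e)"
    by (simp add: Limsup_le_iff)
  then show "\<forall>\<^sub>F x in F. enn2real (g x) < enn2real c + e"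
    using g
  proof eventually_elim
    case (elim x)
    then have "ennreal (enn2real (g x)) < ennreal (enn2real c + e)"
      by simp
    then show ?case
      by (simp add: ennreal_less_iff)
  qed
next
  assume R: "\<forall>e>0. \<forall>\<^sub>F x in F. enn2real (g x) < enn2real c + e"
  show "Limsup F g \<le> c"
    unfolding Limsup_le_iff
  proof (intro allI impI)
    fix y assume y: "c < y"
    show "\<forall>\<^sub>F x in F. g x < y"
    proof (cases "y = top")
      case True
      then show ?thesis using g by simp
    next
      case False
      then have fin: "y < top"
        by (simp add: less_top)
      have "enn2real c < enn2real y"
        using y c by (simp add: enn2real_less_iff fin)
      then have "\<forall>\<^sub>F x in F. enn2real (g x) < enn2real c + (enn2real y - enn2real c)"
        using R by (metis diff_gt_0_iff_gt)
      then show ?thesis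
        using g
      proof eventually_elim
        case (elim x)
        then have "ennreal (enn2real (g x)) < ennreal (enn2real y)"
          by (simp add: ennreal_less_iff)
        then show ?case
          using elim fin by simp
      qed
    qed
  qed
qed

lemma tendsto_enn2real_iff:
  assumes c: "c < top" and g: "\<forall>\<^sub>F x in F. g x < (top::ennreal)"
  shows "((\<lambda>x. enn2real (g x)) \<longlongrightarrow> enn2real c) F \<longleftrightarrow> (g \<longlongrightarrow> c) F"
proof -
  have "((\<lambda>x. enn2real (g x)) \<longlongrightarrow> enn2real c) F
      \<longleftrightarrow> ((\<lambda>x. ennreal (enn2real (g x))) \<longlongrightarrow> ennreal (enn2real c)) F"
    by (rule tendsto_ennreal_iff[symmetric]) auto
  also have "\<dots> \<longleftrightarrow> (g \<longlongrightarrow> c) F"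
    using c by (subst tendsto_cong[OF eventually_mono[OF g]]) simp_all
  finally show ?thesis by simp
qed

section \<open>Riemann sums of decreasing functions\<close>

text \<open>Keeping the step \<open>h\<close> fixed and letting the interval grow makes this an induction on
  the number of cells.\<close>

lemma decreasing_Riemann_bounds:
  fixes g :: "real \<Rightarrow> real"
  assumes dec: "\<And>s t. s \<le> t \<Longrightarrow> g t \<le> g s" and h: "0 \<le> h"
  shows "h * (\<Sum>i<N. g (a + real (Suc i) * h)) \<le> integral {a..a + real N * h} g"
    and "integral {a..a + real N * h} g \<le> h * (\<Sum>i<N. g (a + real i * h))"
proof -
  have int: "g integrable_on {c..d}" for c d
  proof -
    have "mono_on {c..d} (\<lambda>t. - g t)"
      by (intro mono_onI) (simp add: dec)
    from integrable_neg[OF integrable_on_mono_on[OF this]] show ?thesis by simp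
  qed
  have "h * (\<Sum>i<N. g (a + real (Suc i) * h)) \<le> integral {a..a + real N * h} g
      \<and> integral {a..a + real N * h} g \<le> h * (\<Sum>i<N. g (a + real i * h))"
  proof (induction N)
    case (Suc N)
    let ?s = "a + real N * h" and ?t = "a + real (Suc N) * h"
    have st: "a \<le> ?s" "?s \<le> ?t" "?t - ?s = h"
      using h by (auto simp: algebra_simps)
    have "integral {a..?s} g + integral {?s..?t} g = integral {a..?t} g"
      by (rule Henstock_Kurzweil_Integration.integral_combine) (use st int in auto)
    moreover have "integral {?s..?t} g \<le> integral {?s..?t} (\<lambda>_. g ?s)"
      by (rule integral_le) (use int dec in auto)
    moreover have "integral {?s..?t} (\<lambda>_. g ?t) \<le> integral {?s..?t} g"
      by (rule integral_le) (use int dec in auto)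
    ultimately show ?case
      using Suc st by (simp add: algebra_simps)
  qed simp
  then show "h * (\<Sum>i<N. g (a + real (Suc i) * h)) \<le> integral {a..a + real N * h} g"
    and "integral {a..a + real N * h} g \<le> h * (\<Sum>i<N. g (a + real i * h))"
    by auto
qed

lemma uniform_mesh:
  fixes a b e M :: real
  assumes ab: "a < b" and e: "0 < e" and M: "0 \<le> M"
  obtains N :: nat and h where "0 < h" "real N * h = b - a" "h * M < e"
proof -
  obtain N where N: "(b - a) * M / e < real N"
    using reals_Archimedean2 by blast
  moreover have "0 \<le> (b - a) * M / e"
    using ab e M by simp
  ultimately have pos: "0 < real N"
    by linarith
  show ?thesis
  proof (rule that[of "(b - a) / real N" N])
    have "(b - a) * M < real N * e"
      using N e by (simp add: pos_divide_less_eq)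
    then have "(b - a) * M / real N < e"
      using pos by (simp add: pos_divide_less_eq mult.commute)
    then show "(b - a) / real N * M < e"
      by simp
  qed (use ab pos in auto)
qed

section \<open>Topological measures on compact Hausdorff spaces\<close>

text \<open>The mixed case, an open set inside a closed one, uses that compact subsets of a
  Hausdorff space are closed: inner regularity reduces it to two closed sets.\<close>

lemma topological_measure_mono:
  assumes tm: "topological_measure X \<mu>" and X: "Hausdorff_space X"
    and A: "openin X A \<or> closedin X A" and B: "openin X B \<or> closedin X B" and "A \<subseteq> B"
  shows "\<mu> A \<le> \<mu> B"
proof -
  have inner: "\<mu> U = (SUP K\<in>{K. compactin X K \<and> K \<subseteq> U}. \<mu> K)" if "openin X U" for U
    using tm that by (simp add: topological_measure_def)
  have outer: "\<mu> D = (INF U\<in>{U. openin X U \<and> D \<subseteq> U}. \<mu> U)" if "closedin X D" for D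
    using tm that by (simp add: topological_measure_def)
  have closed: "\<mu> D \<le> \<mu> E" if "closedin X D" "closedin X E" "D \<subseteq> E" for D E
    unfolding outer[OF that(1)] outer[OF that(2)] using that(3) by (intro INF_superset_mono) auto
  consider "openin X A" "openin X B" | "openin X A" "closedin X B"
    | "closedin X A" "openin X B" | "closedin X A" "closedin X B"
    using A B by blast
  then show ?thesis
  proof cases
    case 1
    then show ?thesis using topological_measure_open_mono[OF tm] \<open>A \<subseteq> B\<close> by blast
  next
    case 2
    show ?thesis
      unfolding inner[OF 2(1)]
      using 2 \<open>A \<subseteq> B\<close> closed compactin_imp_closedin[OF X] by (intro SUP_least) blast
  next
    case 3
    show ?thesis
      unfolding outer[OF 3(1)] using 3 \<open>A \<subseteq> B\<close> by (intro INF_lower) blast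
  next
    case 4
    then show ?thesis using closed \<open>A \<subseteq> B\<close> by blast
  qed
qed

locale compact_Hausdorff =
  fixes X :: "'a topology"
  assumes compact: "compact_space X" and Hausdorff: "Hausdorff_space X"
begin

lemma finite_mass:
  assumes \<mu>: "finite_topological_measure X \<mu>" and A: "openin X A \<or> closedin X A"
  shows "\<mu> A < top"
proof -
  have "\<mu> A \<le> \<mu> (topspace X)"
    using \<mu> A by (intro topological_measure_mono[OF _ Hausdorff])
      (auto simp: finite_topological_measure_def dest: openin_subset closedin_subset)
  then show ?thesis
    using \<mu> by (auto simp: finite_topological_measure_def intro: le_less_trans)
qed

lemma mass_mono:
  assumes "finite_topological_measure X \<mu>" "A \<subseteq> B"
    and "openin X A \<or> closedin X A" "openin X B \<or> closedin X B"
  shows "enn2real (\<mu> A) \<le> enn2real (\<mu> B)"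
  using assms topological_measure_mono[OF _ Hausdorff] finite_mass
  by (intro enn2real_mono) (auto simp: finite_topological_measure_def)

lemma mass_complement:
  assumes \<mu>: "finite_topological_measure X \<mu>" and U: "openin X U"
  shows "enn2real (\<mu> (topspace X - U)) = enn2real (\<mu> (topspace X)) - enn2real (\<mu> U)"
proof -
  have D: "closedin X (topspace X - U)"
    using U by blast
  have whole: "U \<union> (topspace X - U) = topspace X"
    using openin_subset[OF U] by blast
  have "\<mu> (U \<union> (topspace X - U)) = \<mu> U + \<mu> (topspace X - U)"
    using \<mu> U closedin_compact_space[OF compact D] openin_topspace[of X] whole
    unfolding finite_topological_measure_def topological_measure_def by (metis Diff_disjoint)
  then have "enn2real (\<mu> (topspace X)) = enn2real (\<mu> U) + enn2real (\<mu> (topspace X - U))"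
    unfolding whole using finite_mass[OF \<mu>] U D by (simp add: enn2real_plus)
  then show ?thesis
    by simp
qed

lemma open_mass_compact_approx:
  assumes \<mu>: "finite_topological_measure X \<mu>" and U: "openin X U" and e: "0 < e"
  obtains K where "closedin X K" "K \<subseteq> U" "enn2real (\<mu> U) - e < enn2real (\<mu> K)"
proof (cases "enn2real (\<mu> U) < e")
  case True
  have "enn2real (\<mu> U) - e < enn2real (\<mu> {})"
    by (rule less_le_trans[of _ 0]) (use True in auto)
  then show ?thesis
    by (intro that[of "{}"]) auto
next
  case False
  have "ennreal (enn2real (\<mu> U) - e) < ennreal (enn2real (\<mu> U))"
    using False e by (simp add: ennreal_less_iff)
  also have "\<dots> = \<mu> U"
    using finite_mass[OF \<mu>] U by simp
  also have "\<dots> = (SUP K\<in>{K. compactin X K \<and> K \<subseteq> U}. \<mu> K)"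
    using \<mu> U by (simp add: finite_topological_measure_def topological_measure_def)
  finally obtain K where K: "compactin X K" "K \<subseteq> U" "ennreal (enn2real (\<mu> U) - e) < \<mu> K"
    unfolding less_SUP_iff by auto
  have cl: "closedin X K"
    using K(1) compactin_imp_closedin[OF Hausdorff] by blast
  have "ennreal (enn2real (\<mu> U) - e) < ennreal (enn2real (\<mu> K))"
    using K(3) finite_mass[OF \<mu>, of K] cl by simp
  then have "enn2real (\<mu> U) - e < enn2real (\<mu> K)"
    using False by (simp add: ennreal_less_iff)
  then show ?thesis
    using that cl K(2) by blast
qed

lemma openin_superlevel:
  "continuous_map X euclideanreal f \<Longrightarrow> openin X {x \<in> topspace X. f x \<in> {t<..}}"
  using openin_continuous_map_preimage[of X euclideanreal f "{t<..}"] by simp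

lemma closedin_superlevel:
  "continuous_map X euclideanreal f \<Longrightarrow> closedin X {x \<in> topspace X. f x \<in> {t..}}"
  using closedin_continuous_map_preimage[of X euclideanreal f "{t..}"] by simp

lemma C0_plus_iff:
  "f \<in> C0_plus X \<longleftrightarrow> continuous_map X euclideanreal f \<and> (\<forall>x\<in>topspace X. 0 \<le> f x)"
proof -
  have "compactin X {x \<in> topspace X. e \<le> \<bar>f x\<bar>}" if f: "continuous_map X euclideanreal f" for e
  proof -
    have "closedin X {x \<in> topspace X. \<bar>f x\<bar> \<in> {e..}}"
      by (rule closedin_superlevel) (intro continuous_map_real_abs f)
    then show ?thesis
      using closedin_compact_space[OF compact] by simp
  qed
  then show ?thesis
    unfolding C0_plus_def by blast
qed

lemma continuous_map_range_in_interval: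
  assumes f: "continuous_map X euclideanreal f"
  obtains a b where "a < b" "f ` topspace X \<subseteq> {a..b}"
proof -
  have "compactin euclideanreal (f ` topspace X)"
    using image_compactin[OF _ f] compact by (simp add: compact_space_def)
  then have "bounded (f ` topspace X)"
    by (simp add: compact_imp_bounded)
  then obtain c where c: "\<forall>y\<in>f ` topspace X. \<bar>y\<bar> \<le> c"
    by (auto simp: bounded_iff)
  show ?thesis
  proof (rule that[of "- \<bar>c\<bar> - 1" "\<bar>c\<bar> + 1"])
    show "f ` topspace X \<subseteq> {- \<bar>c\<bar> - 1..\<bar>c\<bar> + 1}"
    proof
      fix y assume "y \<in> f ` topspace X"
      with c have "\<bar>y\<bar> \<le> c"
        by blast
      then show "y \<in> {- \<bar>c\<bar> - 1..\<bar>c\<bar> + 1}"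
        by auto
    qed
  qed simp
qed

lemma R2_decreasing:
  assumes "finite_topological_measure X \<mu>" "continuous_map X euclideanreal f" "s \<le> t"
  shows "R2 X \<mu> f t \<le> R2 X \<mu> f s"
  unfolding R2_def
  by (rule mass_mono[OF assms(1)]) (use assms closedin_superlevel in auto)

lemma R1_le_R2:
  assumes "finite_topological_measure X \<mu>" "continuous_map X euclideanreal f"
  shows "R1 X \<mu> f t \<le> R2 X \<mu> f t"
  unfolding R1_def R2_def
  by (rule mass_mono[OF assms(1)]) (use assms closedin_superlevel openin_superlevel in auto)

lemma R2_le_R1:
  assumes "finite_topological_measure X \<mu>" "continuous_map X euclideanreal f" "s < t"
  shows "R2 X \<mu> f t \<le> R1 X \<mu> f s"
  unfolding R1_def R2_def
  by (rule mass_mono[OF assms(1)]) (use assms closedin_superlevel openin_superlevel in auto)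

text \<open>Continuity from the right suffices: the closed layers above \<open>t\<close> lie in the open
  layer at \<open>t\<close>.\<close>

lemma R1_eq_R2_at_continuity_point:
  assumes \<mu>: "finite_topological_measure X \<mu>" and f: "continuous_map X euclideanreal f"
    and t: "isCont (R2 X \<mu> f) t"
  shows "R1 X \<mu> f t = R2 X \<mu> f t"
proof (rule antisym[OF R1_le_R2[OF \<mu> f]])
  have "(R2 X \<mu> f \<longlongrightarrow> R2 X \<mu> f t) (at_right t)"
    using t by (auto simp: isCont_def intro: filterlim_mono at_le)
  moreover have "\<forall>\<^sub>F s in at_right t. R2 X \<mu> f s \<le> R1 X \<mu> f t"
    unfolding eventually_at_filter by (auto intro: always_eventually R2_le_R1[OF \<mu> f])
  ultimately show "R2 X \<mu> f t \<le> R1 X \<mu> f t"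
    by (rule tendsto_upperbound) simp
qed

lemma R2_continuity_point_between:
  assumes \<mu>: "finite_topological_measure X \<mu>" and f: "continuous_map X euclideanreal f" and "a < b"
  obtains t where "a < t" "t < b" "isCont (R2 X \<mu> f) t"
proof -
  have "mono (\<lambda>t. - R2 X \<mu> f t)"
    by (intro monoI) (simp add: R2_decreasing[OF \<mu> f])
  then have "countable {t. \<not> isCont (\<lambda>t. - R2 X \<mu> f t) t}"
    by (rule mono_ctble_discont)
  then have "\<not> {a<..<b} \<subseteq> {t. \<not> isCont (\<lambda>t. - R2 X \<mu> f t) t}"
    using countable_subset uncountable_open_interval \<open>a < b\<close> by blast
  then obtain t where "a < t" "t < b" "isCont (\<lambda>t. - R2 X \<mu> f t) t"
    by auto
  then show ?thesis
    using that isCont_minus[of t "\<lambda>t. - R2 X \<mu> f t"] by auto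
qed

text \<open>A Urysohn function is the continuous stand-in for the indicator of an open set: whatever
  the measure, its layers strictly between the extreme values are squeezed between
  \<open>K\<close> and \<open>U\<close>.\<close>

lemma Urysohn_layer:
  assumes K: "closedin X K" and U: "openin X U" and "K \<subseteq> U"
  obtains f where "continuous_map X euclideanreal f" "f ` topspace X \<subseteq> {0..1}"
    "\<forall>\<mu> t. finite_topological_measure X \<mu> \<longrightarrow> t < 1 \<longrightarrow> enn2real (\<mu> K) \<le> R1 X \<mu> f t"
    "\<forall>\<mu> t. finite_topological_measure X \<mu> \<longrightarrow> 0 \<le> t \<longrightarrow> R1 X \<mu> f t \<le> enn2real (\<mu> U)"
    "\<forall>\<mu> t. finite_topological_measure X \<mu> \<longrightarrow> 0 < t \<longrightarrow> R2 X \<mu> f t \<le> enn2real (\<mu> U)"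
proof -
  have "normal_space X"
    using compact Hausdorff compact_Hausdorff_or_regular_imp_normal_space by blast
  moreover have "closedin X (topspace X - U)" "disjnt (topspace X - U) K"
    using U \<open>K \<subseteq> U\<close> by (auto simp: disjnt_def)
  ultimately obtain f where f: "continuous_map X (top_of_set {0..1::real}) f"
      and f0: "f ` (topspace X - U) \<subseteq> {0}" and f1: "f ` K \<subseteq> {1}"
    using Urysohn_lemma[of X "topspace X - U" K 0 1] K by auto
  have fc: "continuous_map X euclideanreal f" and fr: "f ` topspace X \<subseteq> {0..1}"
    using f by (auto simp: continuous_map_in_subtopology)
  note sets = openin_superlevel[OF fc] closedin_superlevel[OF fc] U K
  have KR: "K \<subseteq> {x \<in> topspace X. f x \<in> {t<..}}" if "t < 1" for t
    using that f1 closedin_subset[OF K] by fastforce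
  have R1U: "{x \<in> topspace X. f x \<in> {t<..}} \<subseteq> U" if "0 \<le> t" for t
    using that f0 by fastforce
  have R2U: "{x \<in> topspace X. f x \<in> {t..}} \<subseteq> U" if "0 < t" for t
    using that f0 by fastforce
  show ?thesis
  proof (rule that[OF fc fr]; intro allI impI)
    fix \<mu> :: "'a set \<Rightarrow> ennreal" and t :: real
    assume \<mu>: "finite_topological_measure X \<mu>"
    assume t: "t < 1"
    show "enn2real (\<mu> K) \<le> R1 X \<mu> f t"
      unfolding R1_def using sets by (intro mass_mono[OF \<mu> KR[OF t]]) blast+
  next
    fix \<mu> :: "'a set \<Rightarrow> ennreal" and t :: real
    assume \<mu>: "finite_topological_measure X \<mu>"
    assume t: "0 \<le> t"
    show "R1 X \<mu> f t \<le> enn2real (\<mu> U)"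
      unfolding R1_def using sets by (intro mass_mono[OF \<mu> R1U[OF t]]) blast+
  next
    fix \<mu> :: "'a set \<Rightarrow> ennreal" and t :: real
    assume \<mu>: "finite_topological_measure X \<mu>"
    assume t: "0 < t"
    show "R2 X \<mu> f t \<le> enn2real (\<mu> U)"
      unfolding R2_def using sets by (intro mass_mono[OF \<mu> R2U[OF t]]) blast+
  qed
qed

lemma quasi_integral_unit_range_bounds:
  assumes \<mu>: "finite_topological_measure X \<mu>" and f: "continuous_map X euclideanreal f"
    and range: "f ` topspace X \<subseteq> {0..1}"
  shows "(\<And>t. 0 \<le> t \<Longrightarrow> R1 X \<mu> f t \<le> c) \<Longrightarrow> quasi_integral X \<mu> f \<le> c"
    and "(\<And>t. t < 1 \<Longrightarrow> c \<le> R1 X \<mu> f t) \<Longrightarrow> c \<le> quasi_integral X \<mu> f"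
proof -
  have eq: "quasi_integral X \<mu> f = integral {0..1} (R1 X \<mu> f)"
    using quasi_integral_eq[OF \<mu> f _ range] by simp
  show "quasi_integral X \<mu> f \<le> c" if "\<And>t. 0 \<le> t \<Longrightarrow> R1 X \<mu> f t \<le> c"
    using integral_le[of "R1 X \<mu> f" "{0..1}" "\<lambda>_. c"] that R1_integrable[OF \<mu> f]
    by (simp add: eq integrable_const_ivl)
  show "c \<le> quasi_integral X \<mu> f" if c: "\<And>t. t < 1 \<Longrightarrow> c \<le> R1 X \<mu> f t"
  proof -
    \<comment> \<open>The bound may fail at the single point 1, which does not affect the integral.\<close>
    have "integral {0..1} (\<lambda>t. if t = 1 then c else R1 X \<mu> f t) = integral {0..1} (R1 X \<mu> f)"
      by (rule integral_spike[of "{1}"]) auto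
    moreover have "(\<lambda>t. if t = 1 then c else R1 X \<mu> f t) integrable_on {0..1}"
      by (rule integrable_spike[OF R1_integrable[OF \<mu> f], of "{1}"]) auto
    ultimately show ?thesis
      using integral_le[of "\<lambda>_. c" "{0..1}" "\<lambda>t. if t = 1 then c else R1 X \<mu> f t"] c
      by (simp add: eq integrable_const_ivl)
  qed
qed

lemma quasi_integral_one:
  assumes "finite_topological_measure X \<mu>"
  shows "quasi_integral X \<mu> (\<lambda>_. 1) = enn2real (\<mu> (topspace X))"
  using quasi_integral_eq[OF assms, of "\<lambda>_. 1" 1 1] by auto

end

section \<open>Convergence of topological measures along a filter\<close>

locale topological_measure_filter = compact_Hausdorff X
  for X :: "'a topology" +
  fixes \<mu> :: "'a set \<Rightarrow> ennreal" and \<nu> :: "'i \<Rightarrow> 'a set \<Rightarrow> ennreal" and F :: "'i filter"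
  assumes limit: "finite_topological_measure X \<mu>"
    and net: "\<forall>\<^sub>F \<alpha> in F. finite_topological_measure X (\<nu> \<alpha>)"
begin

definition open_lower_bounds where
  "open_lower_bounds \<longleftrightarrow> (\<forall>U. openin X U \<longrightarrow>
     (\<forall>e>0. \<forall>\<^sub>F \<alpha> in F. enn2real (\<mu> U) - e < enn2real (\<nu> \<alpha> U)))"

definition closed_upper_bounds where
  "closed_upper_bounds \<longleftrightarrow> (\<forall>D. closedin X D \<longrightarrow>
     (\<forall>e>0. \<forall>\<^sub>F \<alpha> in F. enn2real (\<nu> \<alpha> D) < enn2real (\<mu> D) + e))"

definition total_mass_converges where
  "total_mass_converges \<longleftrightarrow>
     ((\<lambda>\<alpha>. enn2real (\<nu> \<alpha> (topspace X))) \<longlongrightarrow> enn2real (\<mu> (topspace X))) F"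

lemma finite_net_mass:
  "openin X A \<or> closedin X A \<Longrightarrow> \<forall>\<^sub>F \<alpha> in F. \<nu> \<alpha> A < top"
  using net by eventually_elim (rule finite_mass)

lemma open_lower_bounds_iff_Liminf:
  "open_lower_bounds \<longleftrightarrow> (\<forall>U. openin X U \<longrightarrow> \<mu> U \<le> Liminf F (\<lambda>\<alpha>. \<nu> \<alpha> U))"
  using finite_mass[OF limit] finite_net_mass
  by (simp add: open_lower_bounds_def le_Liminf_enn2real_iff)

lemma closed_upper_bounds_iff_Limsup:
  "closed_upper_bounds \<longleftrightarrow> (\<forall>D. closedin X D \<longrightarrow> Limsup F (\<lambda>\<alpha>. \<nu> \<alpha> D) \<le> \<mu> D)"
  using finite_mass[OF limit] finite_net_mass
  by (simp add: closed_upper_bounds_def Limsup_le_enn2real_iff)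

lemma mass_tendsto_iff:
  "openin X A \<or> closedin X A \<Longrightarrow>
    ((\<lambda>\<alpha>. enn2real (\<nu> \<alpha> A)) \<longlongrightarrow> enn2real (\<mu> A)) F \<longleftrightarrow> ((\<lambda>\<alpha>. \<nu> \<alpha> A) \<longlongrightarrow> \<mu> A) F"
  by (rule tendsto_enn2real_iff[OF finite_mass[OF limit] finite_net_mass])

lemma total_mass_converges_iff:
  "total_mass_converges \<longleftrightarrow> ((\<lambda>\<alpha>. \<nu> \<alpha> (topspace X)) \<longlongrightarrow> \<mu> (topspace X)) F"
  by (simp add: total_mass_converges_def mass_tendsto_iff)

text \<open>The total mass is needed here because complementation trades the mass of a set for
  the difference from the total mass.\<close>

lemma open_liminf_iff_closed_limsup:
  assumes total: total_mass_converges
  shows "open_lower_bounds \<longleftrightarrow> closed_upper_bounds"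
proof
  have upper: "\<forall>\<^sub>F \<alpha> in F. enn2real (\<nu> \<alpha> (topspace X)) < enn2real (\<mu> (topspace X)) + e"
    if "0 < e" for e
    using total that unfolding total_mass_converges_def tendsto_real_iff_bounds by auto
  assume opens: open_lower_bounds
  show closed_upper_bounds
    unfolding closed_upper_bounds_def
  proof (intro allI impI)
    fix D and e :: real assume D: "closedin X D" and e: "0 < e"
    let ?U = "topspace X - D"
    have U: "openin X ?U" and DU: "topspace X - ?U = D"
      using D closedin_subset[OF D] by auto
    have "\<forall>\<^sub>F \<alpha> in F. enn2real (\<mu> ?U) - e / 2 < enn2real (\<nu> \<alpha> ?U)"
      using opens U e unfolding open_lower_bounds_def by simp
    then show "\<forall>\<^sub>F \<alpha> in F. enn2real (\<nu> \<alpha> D) < enn2real (\<mu> D) + e"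
      using upper[OF half_gt_zero[OF e]] net
    proof eventually_elim
      case (elim \<alpha>)
      then show ?case
        using mass_complement[OF limit U] mass_complement[OF elim(3) U]
        unfolding DU by linarith
    qed
  qed
next
  have lower: "\<forall>\<^sub>F \<alpha> in F. enn2real (\<mu> (topspace X)) - e < enn2real (\<nu> \<alpha> (topspace X))"
    if "0 < e" for e
    using total that unfolding total_mass_converges_def tendsto_real_iff_bounds by auto
  assume closeds: closed_upper_bounds
  show open_lower_bounds
    unfolding open_lower_bounds_def
  proof (intro allI impI)
    fix U and e :: real assume U: "openin X U" and e: "0 < e"
    let ?D = "topspace X - U"
    have D: "closedin X ?D"
      using U by blast
    have "\<forall>\<^sub>F \<alpha> in F. enn2real (\<nu> \<alpha> ?D) < enn2real (\<mu> ?D) + e / 2"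
      using closeds D e unfolding closed_upper_bounds_def by simp
    then show "\<forall>\<^sub>F \<alpha> in F. enn2real (\<mu> U) - e < enn2real (\<nu> \<alpha> U)"
      using lower[OF half_gt_zero[OF e]] net
    proof eventually_elim
      case (elim \<alpha>)
      then show ?case
        using mass_complement[OF limit U] mass_complement[OF elim(3) U] by linarith
    qed
  qed
qed

lemma continuity_set_mass_converges:
  assumes opens: open_lower_bounds and closeds: closed_upper_bounds
    and A: "openin X A \<or> closedin X A" and cont: "continuity_set X \<mu> A"
  shows "((\<lambda>\<alpha>. enn2real (\<nu> \<alpha> A)) \<longlongrightarrow> enn2real (\<mu> A)) F"
proof -
  let ?C = "X closure_of A" and ?I = "X interior_of A"
  have sub: "?I \<subseteq> A" "A \<subseteq> ?C"
    using cont by (auto simp: continuity_set_def interior_of_subset closure_of_subset)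
  have mono: "enn2real (\<rho> ?I) \<le> enn2real (\<rho> A)" "enn2real (\<rho> A) \<le> enn2real (\<rho> ?C)"
    if "finite_topological_measure X \<rho>" for \<rho>
    using mass_mono[OF that sub(1)] mass_mono[OF that sub(2)] A by auto
  have "enn2real (\<mu> ?C) = enn2real (\<mu> ?I)"
    using cont by (simp add: continuity_set_def)
  with mono[OF limit] have eq: "enn2real (\<mu> ?I) = enn2real (\<mu> A)" "enn2real (\<mu> ?C) = enn2real (\<mu> A)"
    by linarith+
  show ?thesis
    unfolding tendsto_real_iff_bounds
  proof (intro conjI allI impI)
    fix e :: real assume "0 < e"
    then have "\<forall>\<^sub>F \<alpha> in F. enn2real (\<mu> ?I) - e < enn2real (\<nu> \<alpha> ?I)"
      using opens unfolding open_lower_bounds_def by simp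
    then show "\<forall>\<^sub>F \<alpha> in F. enn2real (\<mu> A) - e < enn2real (\<nu> \<alpha> A)"
      using net
    proof eventually_elim
      case (elim \<alpha>)
      then show ?case using mono[OF elim(2)] eq by linarith
    qed
  next
    fix e :: real assume "0 < e"
    then have "\<forall>\<^sub>F \<alpha> in F. enn2real (\<nu> \<alpha> ?C) < enn2real (\<mu> ?C) + e"
      using closeds unfolding closed_upper_bounds_def by simp
    then show "\<forall>\<^sub>F \<alpha> in F. enn2real (\<nu> \<alpha> A) < enn2real (\<mu> A) + e"
      using net
    proof eventually_elim
      case (elim \<alpha>)
      then show ?case using mono[OF elim(2)] eq by linarith
    qed
  qed
qed

text \<open>The closure of \<open>{f > t}\<close> stays inside \<open>{f \<ge> t}\<close>, and the interior of
  \<open>{f \<ge> t}\<close> contains \<open>{f > t}\<close>; so all four masses lie between two equal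
  numbers.\<close>

lemma superlevel_continuity_sets:
  assumes f: "continuous_map X euclideanreal f" and t: "isCont (R2 X \<mu> f) t"
  shows "continuity_set X \<mu> {x \<in> topspace X. f x \<in> {t..}}" (is "continuity_set X \<mu> ?D")
    and "continuity_set X \<mu> {x \<in> topspace X. f x \<in> {t<..}}" (is "continuity_set X \<mu> ?U")
proof -
  have U: "openin X ?U" and D: "closedin X ?D" and UD: "?U \<subseteq> ?D"
    using openin_superlevel[OF f] closedin_superlevel[OF f] by auto
  have "enn2real (\<mu> ?U) = enn2real (\<mu> ?D)"
    using R1_eq_R2_at_continuity_point[OF limit f t] unfolding R1_def R2_def .
  moreover have "\<mu> ?U < top" "\<mu> ?D < top"
    using finite_mass[OF limit] U D by blast+
  moreover have "x = y" if "enn2real x = enn2real y" "x < top" "y < top" for x y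
    using that by (metis ennreal_enn2real)
  ultimately have eq: "\<mu> ?U = \<mu> ?D"
    by blast
  have tm: "topological_measure X \<mu>"
    using limit by (simp add: finite_topological_measure_def)
  note mono = topological_measure_mono[OF tm Hausdorff]
  have "?U \<subseteq> X interior_of ?D"
    using U UD by (rule interior_of_maximal[rotated])
  then have "\<mu> ?U \<le> \<mu> (X interior_of ?D)"
    by (intro mono disjI1[OF U] disjI1[OF openin_interior_of])
  moreover have "\<mu> (X interior_of ?D) \<le> \<mu> ?D"
    by (intro mono interior_of_subset disjI2[OF D] disjI1[OF openin_interior_of])
  ultimately show "continuity_set X \<mu> ?D"
    unfolding continuity_set_def closure_of_closedin[OF D] using eq closedin_subset[OF D] by (intro conjI) auto
  have "X closure_of ?U \<subseteq> ?D"
    using UD D by (rule closure_of_minimal)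
  then have "\<mu> (X closure_of ?U) \<le> \<mu> ?D"
    by (intro mono disjI2[OF D] disjI2[OF closedin_closure_of])
  moreover have "\<mu> ?U \<le> \<mu> (X closure_of ?U)"
    by (intro mono closure_of_subset openin_subset[OF U] disjI1[OF U] disjI2[OF closedin_closure_of])
  ultimately show "continuity_set X \<mu> ?U"
    unfolding continuity_set_def interior_of_openin[OF U] using eq openin_subset[OF U] by (intro conjI) auto
qed

text \<open>Both the integrals and the layers of Urysohn functions produce, for \<open>K \<subseteq> U\<close>,
  an intermediate quantity \<open>q\<close> as in the hypothesis; inner regularity of the limit
  measure then removes \<open>K\<close>.\<close>

lemma open_lower_boundsI:
  assumes "\<And>K U. closedin X K \<Longrightarrow> openin X U \<Longrightarrow> K \<subseteq> U \<Longrightarrow>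
    \<exists>q l. (q \<longlongrightarrow> l) F \<and> enn2real (\<mu> K) \<le> l \<and> (\<forall>\<^sub>F \<alpha> in F. q \<alpha> \<le> enn2real (\<nu> \<alpha> U))"
  shows open_lower_bounds
  unfolding open_lower_bounds_def
proof (intro allI impI)
  fix U and e :: real assume U: "openin X U" and e: "0 < e"
  obtain K where K: "closedin X K" "K \<subseteq> U" "enn2real (\<mu> U) - e < enn2real (\<mu> K)"
    using open_mass_compact_approx[OF limit U e] by blast
  obtain q l where q: "(q \<longlongrightarrow> l) F" and l: "enn2real (\<mu> K) \<le> l"
    and qU: "\<forall>\<^sub>F \<alpha> in F. q \<alpha> \<le> enn2real (\<nu> \<alpha> U)"
    using assms[OF K(1) U K(2)] by blast
  have "\<forall>\<^sub>F \<alpha> in F. enn2real (\<mu> U) - e < q \<alpha>"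
    by (rule order_tendstoD(1)[OF q less_le_trans[OF K(3) l]])
  then show "\<forall>\<^sub>F \<alpha> in F. enn2real (\<mu> U) - e < enn2real (\<nu> \<alpha> U)"
    using qU by eventually_elim linarith
qed

lemma open_lower_bounds_if_integrals_converge:
  assumes int: "\<And>f. continuous_map X euclideanreal f \<Longrightarrow>
    ((\<lambda>\<alpha>. quasi_integral X (\<nu> \<alpha>) f) \<longlongrightarrow> quasi_integral X \<mu> f) F"
  shows open_lower_bounds
proof (rule open_lower_boundsI)
  fix K U assume "closedin X K" "openin X U" "K \<subseteq> U"
  then obtain f where f: "continuous_map X euclideanreal f" "f ` topspace X \<subseteq> {0..1}"
    and fK: "\<forall>\<rho> t. finite_topological_measure X \<rho> \<longrightarrow> t < 1 \<longrightarrow> enn2real (\<rho> K) \<le> R1 X \<rho> f t"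
    and fU: "\<forall>\<rho> t. finite_topological_measure X \<rho> \<longrightarrow> 0 \<le> t \<longrightarrow> R1 X \<rho> f t \<le> enn2real (\<rho> U)"
      "\<forall>\<rho> t. finite_topological_measure X \<rho> \<longrightarrow> 0 < t \<longrightarrow> R2 X \<rho> f t \<le> enn2real (\<rho> U)"
    by (rule Urysohn_layer)
  have "enn2real (\<mu> K) \<le> quasi_integral X \<mu> f"
    by (rule quasi_integral_unit_range_bounds(2)[OF limit f fK[rule_format, OF limit]])
  moreover have "\<forall>\<^sub>F \<alpha> in F. quasi_integral X (\<nu> \<alpha>) f \<le> enn2real (\<nu> \<alpha> U)"
    using net by eventually_elim (rule quasi_integral_unit_range_bounds(1)[OF _ f fU(1)[rule_format]])
  moreover note int[OF f(1)]
  ultimately show "\<exists>q l. (q \<longlongrightarrow> l) F \<and> enn2real (\<mu> K) \<le> l \<and> (\<forall>\<^sub>F \<alpha> in F. q \<alpha> \<le> enn2real (\<nu> \<alpha> U))"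
    by (intro exI conjI)
qed

lemma total_mass_converges_if_integrals_converge:
  assumes "((\<lambda>\<alpha>. quasi_integral X (\<nu> \<alpha>) (\<lambda>_. 1)) \<longlongrightarrow> quasi_integral X \<mu> (\<lambda>_. 1)) F"
  shows total_mass_converges
proof -
  have "\<forall>\<^sub>F \<alpha> in F. quasi_integral X (\<nu> \<alpha>) (\<lambda>_. 1) = enn2real (\<nu> \<alpha> (topspace X))"
    using net by eventually_elim (rule quasi_integral_one)
  from tendsto_cong[OF this] assms show ?thesis
    by (simp add: total_mass_converges_def quasi_integral_one[OF limit])
qed

lemma open_lower_bounds_if_layers_converge:
  assumes layers: "\<And>f t. f \<in> C0_plus X \<Longrightarrow> isCont (R2 X \<mu> f) t \<Longrightarrow>
    ((\<lambda>\<alpha>. R2 X (\<nu> \<alpha>) f t) \<longlongrightarrow> R2 X \<mu> f t) F"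
  shows open_lower_bounds
proof (rule open_lower_boundsI)
  fix K U assume "closedin X K" "openin X U" "K \<subseteq> U"
  then obtain f where f: "continuous_map X euclideanreal f" "f ` topspace X \<subseteq> {0..1}"
    and fK: "\<forall>\<rho> t. finite_topological_measure X \<rho> \<longrightarrow> t < 1 \<longrightarrow> enn2real (\<rho> K) \<le> R1 X \<rho> f t"
    and fU: "\<forall>\<rho> t. finite_topological_measure X \<rho> \<longrightarrow> 0 \<le> t \<longrightarrow> R1 X \<rho> f t \<le> enn2real (\<rho> U)"
      "\<forall>\<rho> t. finite_topological_measure X \<rho> \<longrightarrow> 0 < t \<longrightarrow> R2 X \<rho> f t \<le> enn2real (\<rho> U)"
    by (rule Urysohn_layer)
  obtain t where t: "0 < t" "t < 1" "isCont (R2 X \<mu> f) t"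
    using R2_continuity_point_between[OF limit f(1), of 0 1] by auto
  have "f \<in> C0_plus X"
    using f by (auto simp: C0_plus_iff)
  note layers[OF this t(3)]
  moreover have "enn2real (\<mu> K) \<le> R2 X \<mu> f t"
    using fK[rule_format, OF limit t(2)] R1_le_R2[OF limit f(1)] by (rule order_trans)
  moreover have "\<forall>\<^sub>F \<alpha> in F. R2 X (\<nu> \<alpha>) f t \<le> enn2real (\<nu> \<alpha> U)"
    using net by eventually_elim (rule fU(2)[rule_format, OF _ t(1)])
  ultimately show "\<exists>q l. (q \<longlongrightarrow> l) F \<and> enn2real (\<mu> K) \<le> l \<and> (\<forall>\<^sub>F \<alpha> in F. q \<alpha> \<le> enn2real (\<nu> \<alpha> U))"
    by (intro exI conjI)
qed

text \<open>The layer of the zero function at level \<open>t\<close> is the whole space for every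
  \<open>t \<le> 0\<close>, and is constant in \<open>t\<close> near \<open>-1\<close>.\<close>

lemma total_mass_converges_if_layers_converge:
  assumes layers: "\<And>f t. f \<in> C0_plus X \<Longrightarrow> isCont (R2 X \<mu> f) t \<Longrightarrow>
    ((\<lambda>\<alpha>. R2 X (\<nu> \<alpha>) f t) \<longlongrightarrow> R2 X \<mu> f t) F"
  shows total_mass_converges
proof -
  have whole: "R2 X \<rho> (\<lambda>_. 0) t = enn2real (\<rho> (topspace X))" if "t \<le> 0" for \<rho> t
    using that by (simp add: R2_def)
  have "\<forall>\<^sub>F t in nhds (-1). R2 X \<mu> (\<lambda>_. 0) t = enn2real (\<mu> (topspace X))"
    using eventually_nhds_in_open[of "{..<0::real}" "-1"] by (rule eventually_mono[rotated 2]) (auto simp: whole)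
  then have "isCont (R2 X \<mu> (\<lambda>_. 0)) (-1)"
    by (subst isCont_cong) auto
  then show ?thesis
    using layers[of "\<lambda>_. 0" "-1"] by (simp add: total_mass_converges_def whole C0_plus_iff)
qed

text \<open>A uniform error is distributed over the \<open>N\<close> open layers at the nodes of the
  lower Riemann sum; \<open>N\<close> is fixed beforehand, so finitely many bounds hold simultaneously.
  Replacing the left by the right end points in a sum for the limit measure costs at most one cell
  of height \<open>\<mu> X\<close>.\<close>

lemma integral_R1_lower_bounds:
  assumes opens: open_lower_bounds
    and f: "continuous_map X euclideanreal f" and ab: "a < b" and e: "0 < e"
  shows "\<forall>\<^sub>F \<alpha> in F. integral {a..b} (R1 X \<mu> f) - e < integral {a..b} (R1 X (\<nu> \<alpha>) f)"
proof -
  define M where "M = enn2real (\<mu> (topspace X))"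
  define d where "d = e / 2 / (b - a)"
  have M: "0 \<le> R1 X \<mu> f t" "R1 X \<mu> f t \<le> M" for t
    unfolding R1_def M_def using openin_superlevel[OF f] by (auto intro!: mass_mono[OF limit])
  have d: "0 < d"
    using ab e by (simp add: d_def)
  have d_total: "d * (b - a) = e / 2"
    using nonzero_eq_divide_eq[THEN iffD1, OF _ d_def] ab by auto
  have "0 < e / 4" "0 \<le> M"
    using e M[of 0] by auto
  then obtain N :: nat and h where h: "0 < h" "real N * h = b - a" "h * M < e / 4"
    by (rule uniform_mesh[OF ab])
  define t where "t i = a + real i * h" for i
  have tN: "a + real N * h = b"
    using h by simp
  have "\<forall>\<^sub>F \<alpha> in F. \<forall>i\<in>{..<N}. R1 X \<mu> f (t (Suc i)) - d < R1 X (\<nu> \<alpha>) f (t (Suc i))"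
    unfolding R1_def using opens openin_superlevel[OF f] d
    by (intro eventually_ball_finite ballI) (auto simp: open_lower_bounds_def)
  then show ?thesis
    using net
  proof eventually_elim
    case (elim \<alpha>)
    have "integral {a..b} (R1 X \<mu> f) \<le> h * (\<Sum>i<N. R1 X \<mu> f (t i))"
      using decreasing_Riemann_bounds(2)[where g="R1 X \<mu> f" and h=h and N=N and a=a,
        OF R1_decreasing[OF limit f]] h tN
      by (simp add: t_def)
    also have "\<dots> = h * (\<Sum>i<N. R1 X \<mu> f (t (Suc i))) + h * (R1 X \<mu> f (t 0) - R1 X \<mu> f (t N))"
      using sum_lessThan_telescope'[of "\<lambda>i. R1 X \<mu> f (t i)" N]
      by (simp add: sum_subtractf flip: distrib_left)
    also have "h * (R1 X \<mu> f (t 0) - R1 X \<mu> f (t N)) \<le> h * M"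
      using h M[of "t 0"] M[of "t N"] by (intro mult_left_mono) auto
    also have "h * (\<Sum>i<N. R1 X \<mu> f (t (Suc i))) \<le> h * (\<Sum>i<N. R1 X (\<nu> \<alpha>) f (t (Suc i)) + d)"
      using elim(1) h by (intro mult_left_mono sum_mono) (auto simp: less_eq_real_def algebra_simps)
    also have "\<dots> = h * (\<Sum>i<N. R1 X (\<nu> \<alpha>) f (t (Suc i))) + d * (real N * h)"
      by (simp add: sum.distrib algebra_simps)
    also have "h * (\<Sum>i<N. R1 X (\<nu> \<alpha>) f (t (Suc i))) \<le> integral {a..b} (R1 X (\<nu> \<alpha>) f)"
      using decreasing_Riemann_bounds(1)[where g="R1 X (\<nu> \<alpha>) f" and h=h and N=N and a=a,
        OF R1_decreasing[OF elim(2) f]] h tN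
      by (simp add: t_def)
    finally show ?case
      unfolding h(2) d_total using h(3) e by linarith
  qed
qed

text \<open>The open layers of the net are not controlled from above, so they are enlarged to
  closed ones; a closed layer of the limit measure is then enlarged to the open layer one node
  lower. With the passage from left to right end points this costs two cells of height
  \<open>\<mu> X\<close>.\<close>

lemma integral_R1_upper_bounds:
  assumes closeds: closed_upper_bounds
    and f: "continuous_map X euclideanreal f" and ab: "a < b" and e: "0 < e"
  shows "\<forall>\<^sub>F \<alpha> in F. integral {a..b} (R1 X (\<nu> \<alpha>) f) < integral {a..b} (R1 X \<mu> f) + e"
proof -
  define M where "M = enn2real (\<mu> (topspace X))"
  define d where "d = e / 2 / (b - a)"
  have M: "0 \<le> R1 X \<mu> f t" "R1 X \<mu> f t \<le> M" for t
    unfolding R1_def M_def using openin_superlevel[OF f] by (auto intro!: mass_mono[OF limit])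
  have d: "0 < d"
    using ab e by (simp add: d_def)
  have d_total: "d * (b - a) = e / 2"
    using nonzero_eq_divide_eq[THEN iffD1, OF _ d_def] ab by auto
  have "0 < e / 4" "0 \<le> M"
    using e M[of 0] by auto
  then obtain N :: nat and h where h: "0 < h" "real N * h = b - a" "h * M < e / 4"
    by (rule uniform_mesh[OF ab])
  define t where "t i = a + real i * h" for i
  \<comment> \<open>\<open>s i\<close> is the node before \<open>t i\<close>; the first one lies outside the interval.\<close>
  define s where "s i = t i - h" for i
  have tN: "a + real N * h = b"
    using h by simp
  have sS: "s (Suc i) = t i" for i
    by (simp add: s_def t_def algebra_simps)
  have "\<forall>\<^sub>F \<alpha> in F. \<forall>i\<in>{..<N}. R2 X (\<nu> \<alpha>) f (t i) < R2 X \<mu> f (t i) + d"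
    unfolding R2_def using closeds closedin_superlevel[OF f] d
    by (intro eventually_ball_finite ballI) (auto simp: closed_upper_bounds_def)
  then show ?thesis
    using net
  proof eventually_elim
    case (elim \<alpha>)
    have "integral {a..b} (R1 X (\<nu> \<alpha>) f) \<le> h * (\<Sum>i<N. R1 X (\<nu> \<alpha>) f (t i))"
      using decreasing_Riemann_bounds(2)[where g="R1 X (\<nu> \<alpha>) f" and h=h and N=N and a=a,
        OF R1_decreasing[OF elim(2) f]] h tN
      by (simp add: t_def)
    also have "\<dots> \<le> h * (\<Sum>i<N. R1 X \<mu> f (s i) + d)"
    proof (intro mult_left_mono sum_mono)
      fix i assume "i \<in> {..<N}"
      then have "R2 X (\<nu> \<alpha>) f (t i) < R2 X \<mu> f (t i) + d"
        using elim(1) by blast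
      moreover have "R2 X \<mu> f (t i) \<le> R1 X \<mu> f (s i)"
        using h by (intro R2_le_R1[OF limit f]) (simp add: s_def)
      ultimately show "R1 X (\<nu> \<alpha>) f (t i) \<le> R1 X \<mu> f (s i) + d"
        using R1_le_R2[OF elim(2) f, of "t i"] by linarith
    qed (use h in simp)
    also have "\<dots> = h * (\<Sum>i<N. R1 X \<mu> f (s i)) + d * (real N * h)"
      by (simp add: sum.distrib algebra_simps)
    also have "h * (\<Sum>i<N. R1 X \<mu> f (s i))
        = h * (\<Sum>i<N. R1 X \<mu> f (t (Suc i)))
          + (h * (R1 X \<mu> f (s 0) - R1 X \<mu> f (s N)) + h * (R1 X \<mu> f (t 0) - R1 X \<mu> f (t N)))"
      using sum_lessThan_telescope'[of "\<lambda>i. R1 X \<mu> f (s i)" N]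
        sum_lessThan_telescope'[of "\<lambda>i. R1 X \<mu> f (t i)" N]
      by (simp add: sS sum_subtractf flip: distrib_left)
    also have "h * (R1 X \<mu> f (s 0) - R1 X \<mu> f (s N)) \<le> h * M"
      using h M[of "s 0"] M[of "s N"] by (intro mult_left_mono) auto
    also have "h * (R1 X \<mu> f (t 0) - R1 X \<mu> f (t N)) \<le> h * M"
      using h M[of "t 0"] M[of "t N"] by (intro mult_left_mono) auto
    also have "h * (\<Sum>i<N. R1 X \<mu> f (t (Suc i))) \<le> integral {a..b} (R1 X \<mu> f)"
      using decreasing_Riemann_bounds(1)[where g="R1 X \<mu> f" and h=h and N=N and a=a,
        OF R1_decreasing[OF limit f]] h tN
      by (simp add: t_def)
    finally show ?case
      unfolding h(2) d_total using h(3) e by linarith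
  qed
qed

lemma quasi_integral_converges:
  assumes opens: open_lower_bounds and closeds: closed_upper_bounds
    and total: total_mass_converges and f: "continuous_map X euclideanreal f"
  shows "((\<lambda>\<alpha>. quasi_integral X (\<nu> \<alpha>) f) \<longlongrightarrow> quasi_integral X \<mu> f) F"
proof -
  obtain a b where ab: "a < b" "f ` topspace X \<subseteq> {a..b}"
    using continuous_map_range_in_interval[OF f] by blast
  have eq: "quasi_integral X \<rho> f = integral {a..b} (R1 X \<rho> f) + a * enn2real (\<rho> (topspace X))"
    if "finite_topological_measure X \<rho>" for \<rho>
    by (rule quasi_integral_eq[OF that f _ ab(2)]) (use ab(1) in simp)
  have "((\<lambda>\<alpha>. integral {a..b} (R1 X (\<nu> \<alpha>) f)) \<longlongrightarrow> integral {a..b} (R1 X \<mu> f)) F"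
    unfolding tendsto_real_iff_bounds
    using integral_R1_lower_bounds[OF opens f ab(1)] integral_R1_upper_bounds[OF closeds f ab(1)]
    by blast
  then have "((\<lambda>\<alpha>. integral {a..b} (R1 X (\<nu> \<alpha>) f) + a * enn2real (\<nu> \<alpha> (topspace X)))
      \<longlongrightarrow> quasi_integral X \<mu> f) F"
    unfolding eq[OF limit] using total
    by (intro tendsto_add tendsto_mult_left) (auto simp: total_mass_converges_def)
  moreover have "\<forall>\<^sub>F \<alpha> in F. quasi_integral X (\<nu> \<alpha>) f
      = integral {a..b} (R1 X (\<nu> \<alpha>) f) + a * enn2real (\<nu> \<alpha> (topspace X))"
    using net by eventually_elim (rule eq)
  ultimately show ?thesis
    by (simp add: tendsto_cong)
qed

end

section \<open>The equivalence\<close>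

theorem theorem23:
  fixes X :: "'a topology" and \<mu> :: "'a set \<Rightarrow> ennreal"
    and I :: "'i set" and r :: "('i \<times> 'i) set" and \<nu> :: "'i \<Rightarrow> 'a set \<Rightarrow> ennreal"
  assumes "compact_space X" and "Hausdorff_space X"
    and "finite_topological_measure X \<mu>"
    and "directed_set I r"
    and "\<And>\<alpha>. \<alpha> \<in> I \<Longrightarrow> finite_topological_measure X (\<nu> \<alpha>)"
  shows "let F = net_filter I r;
      c1 = (\<forall>f. continuous_map X euclideanreal f \<longrightarrow>
              ((\<lambda>\<alpha>. quasi_integral X (\<nu> \<alpha>) f) \<longlongrightarrow> quasi_integral X \<mu> f) F);
      c2 = ((\<forall>U. openin X U \<longrightarrow> Liminf F (\<lambda>\<alpha>. \<nu> \<alpha> U) \<ge> \<mu> U) \<and>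
              ((\<lambda>\<alpha>. \<nu> \<alpha> (topspace X)) \<longlongrightarrow> \<mu> (topspace X)) F);
      c3 = ((\<forall>D. closedin X D \<longrightarrow> Limsup F (\<lambda>\<alpha>. \<nu> \<alpha> D) \<le> \<mu> D) \<and>
              ((\<lambda>\<alpha>. \<nu> \<alpha> (topspace X)) \<longlongrightarrow> \<mu> (topspace X)) F);
      c4 = (\<forall>A. (openin X A \<or> closedin X A) \<and> continuity_set X \<mu> A \<longrightarrow>
              ((\<lambda>\<alpha>. \<nu> \<alpha> A) \<longlongrightarrow> \<mu> A) F);
      c5 = (\<forall>f \<in> C0_plus X. \<forall>t. isCont (R2 X \<mu> f) t \<longrightarrow>
              ((\<lambda>\<alpha>. R2 X (\<nu> \<alpha>) f t) \<longlongrightarrow> R2 X \<mu> f t) F \<and>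
              ((\<lambda>\<alpha>. R1 X (\<nu> \<alpha>) f t) \<longlongrightarrow> R1 X \<mu> f t) F)
    in (c1 \<longleftrightarrow> c2) \<and> (c2 \<longleftrightarrow> c3) \<and> (c3 \<longleftrightarrow> c4) \<and> (c4 \<longleftrightarrow> c5)"
proof -
  have net: "\<forall>\<^sub>F \<alpha> in net_filter I r. finite_topological_measure X (\<nu> \<alpha>)"
    unfolding eventually_net_filter[OF assms(4)] using assms(4,5) by (auto simp: directed_set_def)
  interpret topological_measure_filter X \<mu> \<nu> "net_filter I r"
    by unfold_locales (use assms(1-3) net in auto)
  let ?F = "net_filter I r"
  define c1 where "c1 \<longleftrightarrow> (\<forall>f. continuous_map X euclideanreal f \<longrightarrow>
      ((\<lambda>\<alpha>. quasi_integral X (\<nu> \<alpha>) f) \<longlongrightarrow> quasi_integral X \<mu> f) ?F)"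
  define c4 where "c4 \<longleftrightarrow> (\<forall>A. (openin X A \<or> closedin X A) \<and> continuity_set X \<mu> A \<longrightarrow>
      ((\<lambda>\<alpha>. \<nu> \<alpha> A) \<longlongrightarrow> \<mu> A) ?F)"
  define c5 where "c5 \<longleftrightarrow> (\<forall>f \<in> C0_plus X. \<forall>t. isCont (R2 X \<mu> f) t \<longrightarrow>
      ((\<lambda>\<alpha>. R2 X (\<nu> \<alpha>) f t) \<longlongrightarrow> R2 X \<mu> f t) ?F \<and>
      ((\<lambda>\<alpha>. R1 X (\<nu> \<alpha>) f t) \<longlongrightarrow> R1 X \<mu> f t) ?F)"
  have c2_c3: "open_lower_bounds \<and> total_mass_converges \<longleftrightarrow> closed_upper_bounds \<and> total_mass_converges"
    using open_liminf_iff_closed_limsup by blast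
  have c1_c2: "c1 \<Longrightarrow> open_lower_bounds \<and> total_mass_converges"
    unfolding c1_def
    using open_lower_bounds_if_integrals_converge total_mass_converges_if_integrals_converge by simp
  have c2_c1: "open_lower_bounds \<and> total_mass_converges \<Longrightarrow> c1"
    unfolding c1_def using quasi_integral_converges c2_c3 by blast
  have c3_c4: "closed_upper_bounds \<and> total_mass_converges \<Longrightarrow> c4"
    unfolding c4_def using continuity_set_mass_converges mass_tendsto_iff c2_c3 by blast
  have c4_c5: "c4 \<Longrightarrow> c5"
    unfolding c5_def
  proof (intro ballI allI impI)
    fix f t assume c4: c4 and "f \<in> C0_plus X" and t: "isCont (R2 X \<mu> f) t"
    then have f: "continuous_map X euclideanreal f"
      by (simp add: C0_plus_iff)
    show "((\<lambda>\<alpha>. R2 X (\<nu> \<alpha>) f t) \<longlongrightarrow> R2 X \<mu> f t) ?F \<and> ((\<lambda>\<alpha>. R1 X (\<nu> \<alpha>) f t) \<longlongrightarrow> R1 X \<mu> f t) ?F"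
      unfolding R1_def R2_def
      using c4 superlevel_continuity_sets[OF f t] openin_superlevel[OF f] closedin_superlevel[OF f]
        mass_tendsto_iff
      unfolding c4_def by blast
  qed
  have c5_c2: "c5 \<Longrightarrow> open_lower_bounds \<and> total_mass_converges"
    unfolding c5_def
    using open_lower_bounds_if_layers_converge total_mass_converges_if_layers_converge by blast
  show ?thesis
    unfolding Let_def open_lower_bounds_iff_Liminf[symmetric] closed_upper_bounds_iff_Limsup[symmetric]
      total_mass_converges_iff[symmetric] c1_def[symmetric] c4_def[symmetric] c5_def[symmetric]
    using c1_c2 c2_c1 c2_c3 c3_c4 c4_c5 c5_c2 by blast
qed

end
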